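(* Let $m\ge 2$, $a,b\in\mathbb{R}$, and let $\lambda_1,\lambda_2$ be the roots (in $\mathbb{C}$, with multiplicity) of the polynomial $P(\lambda)=\lambda^2+a\lambda+b$. Suppose that $f_1,\dots,f_m\colon\mathbb{N}^{m-1}\to\mathbb{R}$ and $g_1,\dots,g_m\colon\mathbb{N}^{m-1}\to\mathbb{R}$ satisfy, for any distinct $\alpha,\beta\in\{1,\dots,m\}$ and all values in $\mathbb{N}$ of the remaining variables $t^\gamma$, $\gamma\notin\{\alpha,\beta\}$, the conditions $$f_\alpha(t^1,\ldots,\widehat{t^\alpha},\ldots,t^m)\Big|_{t^\beta=0}=f_\beta(t^1,\ldots,\widehat{t^\beta},\ldots,t^m)\Big|_{t^\alpha=0},$$ $$g_\alpha(t^1,\ldots,\widehat{t^\alpha},\ldots,t^m)\Big|_{t^\beta=1}=g_\beta(t^1,\ldots,\widehat{t^\beta},\ldots,t^m)\Big|_{t^\alpha=1},$$ $$f_\alpha(t^1,\ldots,\widehat{t^\alpha},\ldots,t^m)\Big|_{t^\beta=1}=g_\beta(t^1,\ldots,\widehat{t^\beta},\ldots,t^m)\Big|_{t^\alpha=0}.$$ Then there is a unique $x\colon\mathbb{N}^m\to\mathbb{R}$ which verifies $$x(t+2\cdot\mathbf{1})+a\,x(t+\mathbf{1})+b\,x(t)=0,\quad\forall t\in\mathbb{N}^m,$$ $$x(t)\Big|_{t^\gamma=0}=f_\gamma(t^1,\ldots,\widehat{t^\gamma},\ldots,t^m),\qquad x(t)\Big|_{t^\gamma=1}=g_\gamma(t^1,\ldots,\widehat{t^\gamma},\ldots,t^m),$$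 for all $(t^1,\ldots,\widehat{t^\gamma},\ldots,t^m)\in\mathbb{N}^{m-1}$ and all $\gamma\in\{1,\dots,m\}$, and it is given by the following formulas, valid for any $t\in\mathbb{N}^m$ and any $\beta$ with $\mu(t)=t^\beta$: i) If $\lambda_1,\lambda_2\in\mathbb{R}$ and $\lambda_1\ne\lambda_2$, then $$x(t)=\frac{\lambda_1^{t^\beta}-\lambda_2^{t^\beta}}{\lambda_1-\lambda_2}\,g_\beta(t^1-t^\beta+1,\ldots,\widehat{t^\beta},\ldots,t^m-t^\beta+1)-\frac{\lambda_2\lambda_1^{t^\beta}-\lambda_1\lambda_2^{t^\beta}}{\lambda_1-\lambda_2}\,f_\beta(t^1-t^\beta,\ldots,\widehat{t^\beta},\ldots,t^m-t^\beta).$$ ii) If $\lambda_1=\lambda_2$, then $$x(t)=t^\beta\lambda_1^{t^\beta-1}\,g_\beta(t^1-t^\beta+1,\ldots,\widehat{t^\beta},\ldots,t^m-t^\beta+1)-(t^\beta-1)\lambda_1^{t^\beta}\,f_\beta(t^1-t^\beta,\ldots,\widehat{t^\beta},\ldots,t^m-t^\beta).$$ iii) If $\lambda_1,\lambda_2\in\mathbb{C}\setminus\mathbb{R}$, $\lambda_{1},\lambda_2=r(\cos\theta\pm i\sin\theta)$ with $r>0$, $\theta\in(0,2\pi)\setminus\{\pi\}$, then $$x(t)=\frac{r^{t^\beta-1}\sin(t^\beta\theta)}{\sin\theta}\,g_\beta(t^1-t^\beta+1,\ldots,\widehat{t^\beta},\ldots,t^m-t^\beta+1)-\frac{r^{t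^\beta}\sin((t^\beta-1)\theta)}{\sin\theta}\,f_\beta(t^1-t^\beta,\ldots,\widehat{t^\beta},\ldots,t^m-t^\beta).$$
   Context: $\mathbb{N}=\{0,1,2,\dots\}$. For $t=(t^1,\dots,t^m)\in\mathbb{N}^m$ the superscripts on $t$ are indices, not powers (whereas $\lambda_1^{t^\beta}$, $r^{t^\beta}$ are powers with exponent $t^\beta$); $\mathbf{1}=(1,\dots,1)\in\mathbb{N}^m$; $\mu(t)=\min\{t^1,\dots,t^m\}$. The hat denotes omission: $(t^1,\ldots,\widehat{t^\beta},\ldots,t^m)=(t^1,\ldots,t^{\beta-1},t^{\beta+1},\ldots,t^m)\in\mathbb{N}^{m-1}$; similarly $(t^1-c,\ldots,\widehat{t^\beta},\ldots,t^m-c)$ is the tuple of all $t^\gamma-c$ with $\gamma\ne\beta$, in increasing order of $\gamma$. Conventions: $0^0=1$, and $k\lambda^{k-1}$ is read as $0$ when $k=0$ (also if $\lambda=0$). *)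

theory Defs
  imports
    "HOL-Computational_Algebra.Computational_Algebra"
    "HOL-Library.FuncSet"
begin

(* A point of N^m is a list of length m; the component t^(i+1) is t ! i, so the index set
   {1,...,m} becomes {0,...,m-1}. *)
definition tuples :: "nat \<Rightarrow> nat list set" where
  "tuples m = {t. length t = m}"

definition omit :: "nat \<Rightarrow> nat list \<Rightarrow> nat list" where
  "omit i t = take i t @ drop (Suc i) t"

definition mu :: "nat list \<Rightarrow> nat" where
  "mu t = Min (set t)"

definition shift :: "nat \<Rightarrow> nat list \<Rightarrow> nat list" where
  "shift c t = map (\<lambda>s. s + c) t"

(* Subtraction is truncated on nat; it is only applied with c = mu t to components of t,
   where no truncation occurs. *)
definition unshift :: "nat \<Rightarrow> nat list \<Rightarrow> nat list" where
  "unshift c t = map (\<lambda>s. s - c) t"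

(* A restriction to t^j = c is an update t[j := c]. On both sides of each equation the
   components i and j of t are overwritten or omitted, so t only supplies the remaining ones. *)
definition compatible ::
  "nat \<Rightarrow> (nat \<Rightarrow> nat list \<Rightarrow> real) \<Rightarrow> (nat \<Rightarrow> nat list \<Rightarrow> real) \<Rightarrow> bool" where
  "compatible m f g \<longleftrightarrow>
     (\<forall>i<m. \<forall>j<m. i \<noteq> j \<longrightarrow> (\<forall>t\<in>tuples m.
        f i (omit i (t[j := 0])) = f j (omit j (t[i := 0])) \<and>
        g i (omit i (t[j := 1])) = g j (omit j (t[i := 1])) \<and>
        f i (omit i (t[j := 1])) = g j (omit j (t[i := 0]))))"

definition solves_ivp ::
  "nat \<Rightarrow> real \<Rightarrow> real \<Rightarrow> (nat \<Rightarrow> nat list \<Rightarrow> real) \<Rightarrow> (nat \<Rightarrow> nat list \<Rightarrow> real) \<Rightarrow>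
   (nat list \<Rightarrow> real) \<Rightarrow> bool" where
  "solves_ivp m a b f g x \<longleftrightarrow>
     (\<forall>t\<in>tuples m. x (shift 2 t) + a * x (shift 1 t) + b * x t = 0) \<and>
     (\<forall>t\<in>tuples m. \<forall>k<m. x (t[k := 0]) = f k (omit k t) \<and> x (t[k := 1]) = g k (omit k t))"

end

theory Submission
  imports Defs
begin

text \<open>
  The equation only relates the values of \<open>x\<close> at points that differ by a multiple of
  \<open>(1,\<dots>,1)\<close>, so \<open>\<nat>\<^sup>m\<close> splits into diagonals on which it becomes an ordinary second-order linear
  recurrence in one variable. Each diagonal contains exactly one point \<open>s\<close> with a vanishing
  component, and \<open>t\<close> is the point number \<open>mu t\<close> on its diagonal. If \<open>s\<close> vanishes in the component
  \<open>\<beta>\<close>, then \<open>s\<close> lies on the face prescribed by \<open>f \<beta>\<close> and its successor on the face prescribed by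
  \<open>g \<beta>\<close>. These are exactly the two initial values that the recurrence needs. Hence there is at most one
  solution (\<open>solves_ivp_unique\<close>), and for each closed form it is enough that, as a sequence in
  \<open>mu t\<close>, it satisfies the recurrence and starts correctly (\<open>linear_recurrence_unique\<close>).

  For existence the recurrence is run on each diagonal. Two choices have to be shown harmless, and
  this is what the three compatibility conditions are for. If \<open>s\<close> vanishes in several components,
  the first two conditions say that the initial values do not depend on the component chosen
  (\<open>compatible_initial_eq\<close>). If a point with \<open>t\<^sup>k = 1\<close> has another component equal to \<open>0\<close>,
  it is itself the starting point of a diagonal; its value then comes from some \<open>f \<beta>\<close>, and the third
  condition identifies this value with the prescribed \<open>g k\<close>.
\<close>

section \<open>Second-order linear recurrences in one variable\<close>

lemma linear_recurrence_unique:
  fixes u v :: "nat \<Rightarrow> 'a::comm_ring_1"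
  assumes u: "\<And>n. u (Suc (Suc n)) + p * u (Suc n) + q * u n = 0"
    and v: "\<And>n. v (Suc (Suc n)) + p * v (Suc n) + q * v n = 0"
    and init: "u 0 = v 0" "u 1 = v 1"
  shows "u n = v n"
proof (induction n rule: induct_nat_012)
  case (ge2 n)
  have "u (Suc (Suc n)) = - (p * u (Suc n) + q * u n)"
    using u[of n] by (metis add.assoc eq_neg_iff_add_eq_0)
  also have "\<dots> = - (p * v (Suc n) + q * v n)"
    using ge2 by simp
  also have "\<dots> = v (Suc (Suc n))"
    using v[of n] by (metis add.assoc eq_neg_iff_add_eq_0)
  finally show ?case .
qed (use init in simp_all)

lemma linear_recurrence_combination:
  fixes u v :: "nat \<Rightarrow> 'a::comm_ring_1"
  assumes u: "u (Suc (Suc n)) + p * u (Suc n) + q * u n = 0"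
    and v: "v (Suc (Suc n)) + p * v (Suc n) + q * v n = 0"
  shows "u (Suc (Suc n)) * A - v (Suc (Suc n)) * B
         + p * (u (Suc n) * A - v (Suc n) * B) + q * (u n * A - v n * B) = 0"
proof -
  have "u (Suc (Suc n)) * A - v (Suc (Suc n)) * B
        + p * (u (Suc n) * A - v (Suc n) * B) + q * (u n * A - v n * B)
      = (u (Suc (Suc n)) + p * u (Suc n) + q * u n) * A
        - (v (Suc (Suc n)) + p * v (Suc n) + q * v n) * B"
    by (simp add: algebra_simps)
  thus ?thesis
    by (simp only: u v mult_zero_left diff_self)
qed

text \<open>In all three cases the roots enter the recurrence only through these expressions for its
  coefficients.\<close>

lemma vieta_quadratic:
  fixes p q l1 l2 :: complex
  assumes "proots [:q, p, 1:] = {#l1, l2#}"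
  shows "p = - (l1 + l2)" "q = l1 * l2"
proof -
  have "[:q, p, 1:] = (\<Prod>x\<in>#{#l1, l2#}. [:-x, 1:])"
    using complex_poly_decompose_multiset[of "[:q, p, 1:]"] assms by simp
  thus "p = - (l1 + l2)" "q = l1 * l2"
    by simp_all
qed

lemma linear_recurrence_distinct_roots:
  fixes u :: "nat \<Rightarrow> 'a::field"
  assumes u: "\<And>n. u (Suc (Suc n)) + p * u (Suc n) + q * u n = 0"
    and p: "p = - (l1 + l2)" and q: "q = l1 * l2" and "l1 \<noteq> l2"
  shows "u n = (l1 ^ n - l2 ^ n) / (l1 - l2) * u 1
               - (l2 * l1 ^ n - l1 * l2 ^ n) / (l1 - l2) * u 0"
proof -
  have "l1 - l2 \<noteq> 0"
    using \<open>l1 \<noteq> l2\<close> by simp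
  \<comment> \<open>The coefficients of the two geometric sequences solve the linear system given by \<open>u 0\<close>
    and \<open>u 1\<close>; collecting \<open>u 1\<close> and \<open>u 0\<close> afterwards gives the stated form.\<close>
  have "u n = l1 ^ n * ((u 1 - l2 * u 0) / (l1 - l2)) - l2 ^ n * ((u 1 - l1 * u 0) / (l1 - l2))"
  proof (rule linear_recurrence_unique[where u = u and p = p and q = q, OF u])
    show "l1 ^ Suc (Suc n) * A - l2 ^ Suc (Suc n) * B
          + p * (l1 ^ Suc n * A - l2 ^ Suc n * B) + q * (l1 ^ n * A - l2 ^ n * B) = 0" for n A B
      by (rule linear_recurrence_combination) (simp_all add: p q algebra_simps)
  qed (use \<open>l1 - l2 \<noteq> 0\<close> in \<open>simp_all add: diff_divide_distrib [symmetric] divide_eq_eq eq_divide_eq\<close>,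
      simp_all add: algebra_simps)
  thus ?thesis
    by (simp add: diff_divide_distrib add_divide_distrib algebra_simps)
qed

lemma linear_recurrence_double_root:
  fixes u :: "nat \<Rightarrow> 'a::comm_ring_1"
  assumes u: "\<And>n. u (Suc (Suc n)) + p * u (Suc n) + q * u n = 0"
    and p: "p = - (l + l)" and q: "q = l * l"
  shows "u n = of_nat n * l ^ (n - 1) * u 1 - (of_nat n - 1) * l ^ n * u 0"
proof (rule linear_recurrence_unique[where u = u and p = p and q = q, OF u])
  show "of_nat (Suc (Suc n)) * l ^ (Suc (Suc n) - 1) * u 1
          - (of_nat (Suc (Suc n)) - 1) * l ^ Suc (Suc n) * u 0
        + p * (of_nat (Suc n) * l ^ (Suc n - 1) * u 1 - (of_nat (Suc n) - 1) * l ^ Suc n * u 0)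
        + q * (of_nat n * l ^ (n - 1) * u 1 - (of_nat n - 1) * l ^ n * u 0) = 0" for n
    \<comment> \<open>The exponent \<open>n - 1\<close> is truncated for \<open>n = 0\<close>, where the factor \<open>of_nat n\<close> vanishes.\<close>
    unfolding p q by (cases n) (simp_all add: algebra_simps)
qed simp_all

text \<open>The addition theorem for \<open>sin\<close> yields \<open>sin (\<phi> + \<theta>) + sin (\<phi> - \<theta>) = 2 sin \<phi> cos \<theta>\<close>, so
  \<open>r\<^sup>n sin (n \<theta> + c)\<close> satisfies the recurrence for every phase \<open>c\<close>; the two phases that occur are
  \<open>0\<close> and \<open>- \<theta>\<close>.\<close>

lemma power_sin_recurrence:
  fixes r \<theta> c :: real
  shows "r ^ Suc (Suc n) * sin (real (Suc (Suc n)) * \<theta> + c)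
         - 2 * r * cos \<theta> * (r ^ Suc n * sin (real (Suc n) * \<theta> + c))
         + r\<^sup>2 * (r ^ n * sin (real n * \<theta> + c)) = 0"
proof -
  define \<phi> where "\<phi> = real (Suc n) * \<theta> + c"
  have "real (Suc (Suc n)) * \<theta> + c = \<phi> + \<theta>" "real n * \<theta> + c = \<phi> - \<theta>"
    by (simp_all add: \<phi>_def algebra_simps)
  moreover have "r ^ Suc (Suc n) * sin (\<phi> + \<theta>) - 2 * r * cos \<theta> * (r ^ Suc n * sin \<phi>)
                 + r\<^sup>2 * (r ^ n * sin (\<phi> - \<theta>)) = 0"
    by (simp add: sin_add sin_diff power2_eq_square algebra_simps)
  ultimately show ?thesis
    by (simp only: \<phi>_def)
qed

lemma linear_recurrence_complex_roots:
  fixes u :: "nat \<Rightarrow> real"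
  assumes u: "\<And>n. u (Suc (Suc n)) + p * u (Suc n) + q * u n = 0"
    and p: "p = - (2 * r * cos \<theta>)" and q: "q = r\<^sup>2" and "r \<noteq> 0" and s: "sin \<theta> \<noteq> 0"
  shows "u n = r powi (int n - 1) * sin (real n * \<theta>) / sin \<theta> * u 1
               - r ^ n * sin ((real n - 1) * \<theta>) / sin \<theta> * u 0"
proof -
  define S where "S c n = r ^ n * sin (real n * \<theta> + c)" for c n
  have S: "S c (Suc (Suc n)) + p * S c (Suc n) + q * S c n = 0" for c n
    using power_sin_recurrence[of r n \<theta> c] by (simp add: S_def p q)
  have "u n = S 0 n * (u 1 / (r * sin \<theta>)) - S (- \<theta>) n * (u 0 / sin \<theta>)"
  proof (rule linear_recurrence_unique[where u = u and p = p and q = q, OF u])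
    show "S 0 (Suc (Suc n)) * A - S (- \<theta>) (Suc (Suc n)) * B
          + p * (S 0 (Suc n) * A - S (- \<theta>) (Suc n) * B)
          + q * (S 0 n * A - S (- \<theta>) n * B) = 0" for n A B
      by (rule linear_recurrence_combination) (rule S)+
  qed (use \<open>r \<noteq> 0\<close> s in \<open>simp_all add: S_def\<close>)
  moreover have "r powi (int n - 1) = r ^ n / r"
    using \<open>r \<noteq> 0\<close> by (simp add: power_int_diff)
  moreover have "real n * \<theta> + - \<theta> = (real n - 1) * \<theta>"
    by (simp add: algebra_simps)
  ultimately show ?thesis
    by (simp add: S_def)
qed

section \<open>Diagonals\<close>

lemma shift_in_tuples [simp]: "shift c t \<in> tuples m \<longleftrightarrow> t \<in> tuples m"
  and unshift_in_tuples [simp]: "unshift c t \<in> tuples m \<longleftrightarrow> t \<in> tuples m"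
  and list_update_in_tuples [simp]: "t[i := c] \<in> tuples m \<longleftrightarrow> t \<in> tuples m"
  by (simp_all add: shift_def unshift_def tuples_def)

lemma shift_shift: "shift c (shift d t) = shift (d + c) t"
  and shift_0 [simp]: "shift 0 t = t"
  by (simp_all add: shift_def o_def add.assoc)

lemma unshift_add_shift: "unshift (n + c) (shift c t) = unshift n t"
  by (simp add: shift_def unshift_def)

lemma omit_shift: "omit i (shift c t) = shift c (omit i t)"
  and omit_unshift: "omit i (unshift c t) = unshift c (omit i t)"
  by (simp_all add: omit_def shift_def unshift_def take_map drop_map)

lemma omit_list_update: "omit i (t[i := c]) = omit i t"
  by (simp add: omit_def)

lemma mu_le: "t \<in> tuples m \<Longrightarrow> i < m \<Longrightarrow> mu t \<le> t ! i"
  by (simp add: mu_def tuples_def)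

lemma mu_attained:
  assumes "t \<in> tuples m" "m > 0"
  shows "\<exists>i<m. t ! i = mu t"
proof -
  have "Min (set t) \<in> set t"
    using assms by (intro Min_in) (auto simp: tuples_def)
  thus ?thesis
    using assms by (auto simp: mu_def tuples_def in_set_conv_nth)
qed

lemma shift_unshift_mu:
  "shift (mu t) (unshift (mu t) t) = t"
  by (auto simp: shift_def unshift_def mu_def intro!: map_idI)

lemma mu_shift:
  assumes "t \<in> tuples m" "m > 0"
  shows "mu (shift c t) = mu t + c"
proof -
  obtain i j where "i < m" "t ! i = mu t" "j < m" "shift c t ! j = mu (shift c t)"
    using mu_attained assms shift_in_tuples by meson
  moreover have "mu t \<le> t ! j" "mu (shift c t) \<le> shift c t ! i"
    using assms calculation by (simp_all add: mu_le)
  ultimately show ?thesis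
    using assms by (simp add: shift_def tuples_def)
qed

text \<open>The component \<open>\<beta>\<close> is minimal throughout the diagonal of \<open>t\<close>, so on it the data \<open>f \<beta>\<close> and
  \<open>g \<beta>\<close> prescribe the first two values.\<close>

lemma solves_ivp_on_diagonal:
  assumes x: "solves_ivp m a b f g x"
    and t: "t \<in> tuples m" and \<beta>: "\<beta> < m" "t ! \<beta> = mu t"
  defines "u \<equiv> \<lambda>k. x (shift k (unshift (mu t) t))"
  shows "u (Suc (Suc k)) + a * u (Suc k) + b * u k = 0"
    and "u 0 = f \<beta> (unshift (mu t) (omit \<beta> t))"
    and "u 1 = g \<beta> (shift 1 (unshift (mu t) (omit \<beta> t)))"
    and "u (mu t) = x t"
proof -
  define s where "s = unshift (mu t) t"
  have s: "s \<in> tuples m" "s ! \<beta> = 0" "shift 1 s ! \<beta> = 1"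
    using t \<beta> by (simp_all add: s_def) (simp_all add: shift_def unshift_def tuples_def)
  have "x (shift 2 (shift k s)) + a * x (shift 1 (shift k s)) + b * x (shift k s) = 0"
    using x s(1) unfolding solves_ivp_def by (meson shift_in_tuples)
  thus "u (Suc (Suc k)) + a * u (Suc k) + b * u k = 0"
    by (simp add: u_def s_def shift_shift)
  have face: "x (r[\<beta> := 0]) = f \<beta> (omit \<beta> r)" "x (r[\<beta> := 1]) = g \<beta> (omit \<beta> r)"
    if "r \<in> tuples m" for r
    using x \<beta> that by (auto simp: solves_ivp_def)
  have "s[\<beta> := 0] = s" "(shift 1 s)[\<beta> := 1] = shift 1 s"
    using s by (metis list_update_id)+
  thus "u 0 = f \<beta> (unshift (mu t) (omit \<beta> t))"
    and "u 1 = g \<beta> (shift 1 (unshift (mu t) (omit \<beta> t)))"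
    using face[of s] face[of "shift 1 s"] s(1)
    by (simp_all add: u_def s_def omit_shift omit_unshift)
  show "u (mu t) = x t"
    by (simp add: u_def shift_unshift_mu)
qed

lemma solves_ivp_unique:
  assumes "solves_ivp m a b f g x" "solves_ivp m a b f g y" "t \<in> tuples m" "m > 0"
  shows "x t = y t"
proof -
  obtain \<beta> where \<beta>: "\<beta> < m" "t ! \<beta> = mu t"
    using mu_attained assms by blast
  note dx = solves_ivp_on_diagonal[OF assms(1,3) \<beta>]
    and dy = solves_ivp_on_diagonal[OF assms(2,3) \<beta>]
  have "x (shift (mu t) (unshift (mu t) t)) = y (shift (mu t) (unshift (mu t) t))"
    by (rule linear_recurrence_unique[of "\<lambda>k. x (shift k (unshift (mu t) t))" a b
          "\<lambda>k. y (shift k (unshift (mu t) t))"]) (use dx dy in simp_all)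
  thus ?thesis
    by (simp add: shift_unshift_mu)
qed

section \<open>Existence\<close>

fun linrec :: "'a::comm_ring_1 \<Rightarrow> 'a \<Rightarrow> 'a \<Rightarrow> 'a \<Rightarrow> nat \<Rightarrow> 'a" where
  "linrec p q y0 y1 0 = y0"
| "linrec p q y0 y1 (Suc 0) = y1"
| "linrec p q y0 y1 (Suc (Suc n)) = - p * linrec p q y0 y1 (Suc n) - q * linrec p q y0 y1 n"

text \<open>Only meaningful if \<open>\<beta>\<close> is a minimal component of \<open>t\<close>. It is kept as a parameter so that
  the independence of its choice can be stated, and so that one \<open>\<beta>\<close> can be used along a whole
  diagonal.\<close>

definition diagonal_value ::
  "real \<Rightarrow> real \<Rightarrow> (nat \<Rightarrow> nat list \<Rightarrow> real) \<Rightarrow> (nat \<Rightarrow> nat list \<Rightarrow> real) \<Rightarrow>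
   nat \<Rightarrow> nat list \<Rightarrow> real" where
  "diagonal_value a b f g \<beta> t =
     (let s = unshift (mu t) t
      in linrec a b (f \<beta> (omit \<beta> s)) (g \<beta> (omit \<beta> (shift 1 s))) (mu t))"

lemma compatibleD:
  assumes "compatible m f g" "i < m" "j < m" "i \<noteq> j" "t \<in> tuples m"
  shows "f i (omit i (t[j := 0])) = f j (omit j (t[i := 0]))"
    and "g i (omit i (t[j := 1])) = g j (omit j (t[i := 1]))"
    and "f i (omit i (t[j := 1])) = g j (omit j (t[i := 0]))"
  using assms unfolding compatible_def by blast+

text \<open>Overwriting the components \<open>i\<close> and \<open>j\<close> by the values that they already have turns the
  compatibility conditions into statements about a single point.\<close>

lemma compatible_initial_eq:
  assumes "compatible m f g" "i < m" "j < m" "s \<in> tuples m" "s ! i = 0" "s ! j = 0"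
  shows "f i (omit i s) = f j (omit j s)"
    and "g i (omit i (shift 1 s)) = g j (omit j (shift 1 s))"
proof -
  have "shift 1 s ! i = 1" "shift 1 s ! j = 1"
    using assms by (simp_all add: shift_def tuples_def)
  hence "(shift 1 s)[i := 1] = shift 1 s" "(shift 1 s)[j := 1] = shift 1 s"
        "s[i := 0] = s" "s[j := 0] = s"
    using assms by (metis list_update_id)+
  thus "f i (omit i s) = f j (omit j s)"
    and "g i (omit i (shift 1 s)) = g j (omit j (shift 1 s))"
    using compatibleD(1)[OF assms(1-3), of s] compatibleD(2)[OF assms(1-3), of "shift 1 s"] assms(4)
    by (cases "i = j"; simp)+
qed

lemma diagonal_value_eq:
  assumes "compatible m f g" "t \<in> tuples m" "i < m" "j < m" "t ! i = mu t" "t ! j = mu t"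
  shows "diagonal_value a b f g i t = diagonal_value a b f g j t"
proof -
  have "unshift (mu t) t ! i = 0" "unshift (mu t) t ! j = 0"
    using assms by (simp_all add: unshift_def tuples_def)
  with assms compatible_initial_eq[of m f g i j "unshift (mu t) t"] show ?thesis
    by (simp add: diagonal_value_def)
qed

lemma diagonal_value_recurrence:
  assumes "t \<in> tuples m" "m > 0"
  shows "diagonal_value a b f g \<beta> (shift 2 t) + a * diagonal_value a b f g \<beta> (shift 1 t)
         + b * diagonal_value a b f g \<beta> t = 0"
  using assms by (simp add: diagonal_value_def mu_shift unshift_add_shift Let_def
      del: One_nat_def add_2_eq_Suc add_2_eq_Suc')
    (simp add: numeral_2_eq_2)

lemma diagonal_value_face0:
  assumes "t \<in> tuples m" "k < m" "t ! k = 0"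
  shows "mu t = 0" "diagonal_value a b f g k t = f k (omit k t)"
proof -
  show "mu t = 0"
    using mu_le[of t m k] assms by simp
  thus "diagonal_value a b f g k t = f k (omit k t)"
    by (simp add: diagonal_value_def unshift_def)
qed

text \<open>A component equal to \<open>1\<close> is either minimal, and then \<open>t\<close> is the second point of its
  diagonal, or some other component vanishes; the latter case is the one that needs the mixed
  condition between \<open>f\<close> and \<open>g\<close>.\<close>

lemma diagonal_value_face1:
  assumes c: "compatible m f g" and t: "t \<in> tuples m" and k: "k < m" "t ! k = 1"
    and \<beta>: "\<beta> < m" "t ! \<beta> = mu t"
  shows "diagonal_value a b f g \<beta> t = g k (omit k t)"
proof (cases "mu t = 0")
  case True
  hence "\<beta> \<noteq> k"
    using \<beta> k by auto
  have "t[k := 1] = t" "t[\<beta> := 0] = t"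
    using k \<beta> True by (metis list_update_id)+
  thus ?thesis
    using compatibleD(3)[OF c \<beta>(1) k(1) \<open>\<beta> \<noteq> k\<close> t] diagonal_value_face0(2)[OF t \<beta>(1)] \<beta>(2) True
    by simp
next
  case False
  hence mu: "mu t = 1"
    using mu_le[OF t k(1)] k(2) by simp
  have "diagonal_value a b f g \<beta> t = diagonal_value a b f g k t"
    by (rule diagonal_value_eq[OF c t \<beta>(1) k(1) \<beta>(2)]) (simp add: k mu)
  also have "\<dots> = g k (omit k (shift (mu t) (unshift (mu t) t)))"
    by (simp add: diagonal_value_def mu)
  finally show ?thesis
    by (simp only: shift_unshift_mu)
qed

lemma solves_ivp_exists:
  assumes c: "compatible m f g" and "m > 0"
  shows "\<exists>x. x \<in> tuples m \<rightarrow>\<^sub>E UNIV \<and> solves_ivp m a b f g x"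
proof -
  have "\<forall>t\<in>tuples m. \<exists>i. i < m \<and> t ! i = mu t"
    using mu_attained \<open>m > 0\<close> by blast
  from bchoice[OF this] obtain \<beta>
    where \<beta>: "\<And>t. t \<in> tuples m \<Longrightarrow> \<beta> t < m \<and> t ! \<beta> t = mu t"
    by blast
  define x where "x = restrict (\<lambda>t. diagonal_value a b f g (\<beta> t) t) (tuples m)"
  have x: "x t = diagonal_value a b f g i t" if "t \<in> tuples m" "i < m" "t ! i = mu t" for t i
    using diagonal_value_eq[OF c that(1), of "\<beta> t" i] that \<beta>[OF that(1)] by (simp add: x_def)
  have "x (shift 2 t) + a * x (shift 1 t) + b * x t = 0" if t: "t \<in> tuples m" for t
  proof -
    have "x (shift d t) = diagonal_value a b f g (\<beta> t) (shift d t)" for d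
    proof (rule x)
      show "shift d t ! \<beta> t = mu (shift d t)"
        using \<beta>[OF t] t by (simp add: mu_shift[OF t \<open>m > 0\<close>]) (simp add: shift_def tuples_def)
    qed (use t \<beta> in simp_all)
    from this[of 2] this[of 1] this[of 0] show ?thesis
      using diagonal_value_recurrence[OF t \<open>m > 0\<close>] by simp
  qed
  moreover have "x (t[k := 0]) = f k (omit k t)" if t: "t \<in> tuples m" and k: "k < m" for t k
  proof -
    have t': "t[k := 0] \<in> tuples m" "t[k := 0] ! k = 0"
      using t k by (simp_all add: tuples_def)
    from diagonal_value_face0[OF t'(1) k t'(2)] show ?thesis
      using x[OF t'(1) k] t' by (simp add: omit_list_update)
  qed
  moreover have "x (t[k := 1]) = g k (omit k t)" if t: "t \<in> tuples m" and k: "k < m" for t k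
  proof -
    have t': "t[k := 1] \<in> tuples m" "t[k := 1] ! k = 1"
      using t k by (simp_all add: tuples_def)
    let ?i = "\<beta> (t[k := 1])"
    have i: "?i < m" "t[k := 1] ! ?i = mu (t[k := 1])"
      using \<beta>[OF t'(1)] by blast+
    have "x (t[k := 1]) = diagonal_value a b f g ?i (t[k := 1])"
      by (rule x[OF t'(1) i])
    also have "\<dots> = g k (omit k (t[k := 1]))"
      by (rule diagonal_value_face1[OF c t'(1) k t'(2) i])
    finally show ?thesis
      by (simp only: omit_list_update)
  qed
  ultimately have "solves_ivp m a b f g x"
    unfolding solves_ivp_def by blast
  thus ?thesis
    by (intro exI[of _ x]) (simp add: x_def)
qed

section \<open>The closed forms\<close>

theorem theorem4:
  fixes m :: nat and a b :: real and l1 l2 :: complex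
    and f g :: "nat \<Rightarrow> nat list \<Rightarrow> real"
  assumes "m \<ge> 2"
    and "proots (map_poly complex_of_real [:b, a, 1:]) = {#l1, l2#}"
    and "compatible m f g"
  shows
    "(\<exists>!x. x \<in> tuples m \<rightarrow>\<^sub>E UNIV \<and> solves_ivp m a b f g x) \<and>
     (\<forall>x. x \<in> tuples m \<rightarrow>\<^sub>E UNIV \<and> solves_ivp m a b f g x \<longrightarrow>
       (\<forall>t\<in>tuples m. \<forall>\<beta><m. mu t = t ! \<beta> \<longrightarrow>
         (let n = t ! \<beta>;
              G = g \<beta> (shift 1 (unshift n (omit \<beta> t)));
              F = f \<beta> (unshift n (omit \<beta> t))
          in
           (l1 \<in> \<real> \<and> l2 \<in> \<real> \<and> l1 \<noteq> l2 \<longrightarrow>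
              complex_of_real (x t) =
                (l1 ^ n - l2 ^ n) / (l1 - l2) * complex_of_real G
                - (l2 * l1 ^ n - l1 * l2 ^ n) / (l1 - l2) * complex_of_real F) \<and>
           (l1 = l2 \<longrightarrow>
              complex_of_real (x t) =
                of_nat n * l1 ^ (n - 1) * complex_of_real G
                - (of_nat n - 1) * l1 ^ n * complex_of_real F) \<and>
           (\<forall>r \<theta>. l1 \<notin> \<real> \<and> l2 \<notin> \<real> \<and> r > 0 \<and> \<theta> \<in> {0<..<2 * pi} - {pi} \<and>
              l1 = complex_of_real r * (complex_of_real (cos \<theta>) + \<i> * complex_of_real (sin \<theta>)) \<and>
              l2 = complex_of_real r * (complex_of_real (cos \<theta>) - \<i> * complex_of_real (sin \<theta>)) \<longrightarrow>
              x t =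
                r powi (int n - 1) * sin (real n * \<theta>) / sin \<theta> * G
                - r ^ n * sin ((real n - 1) * \<theta>) / sin \<theta> * F))))"
proof (intro conjI allI ballI impI, goal_cases)
  have m: "m > 0"
    using assms(1) by simp
  case 1
  obtain x where x: "x \<in> tuples m \<rightarrow>\<^sub>E UNIV" "solves_ivp m a b f g x"
    using solves_ivp_exists[OF assms(3) m] by blast
  show ?case
  proof (rule ex1I[of _ x])
    show "y = x" if "y \<in> tuples m \<rightarrow>\<^sub>E UNIV \<and> solves_ivp m a b f g y" for y
    proof (rule PiE_ext)
      show "y \<in> tuples m \<rightarrow>\<^sub>E UNIV"
        using that by blast
      show "y t = x t" if "t \<in> tuples m" for t
        using solves_ivp_unique[OF _ x(2) that m] \<open>_ \<and> solves_ivp m a b f g y\<close> by blast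
    qed (fact x(1))
  qed (use x in blast)
next
  case (2 x t \<beta>)
  define u where "u k = x (shift k (unshift (mu t) t))" for k
  \<comment> \<open>The first two closed forms are identities between complex numbers, because \<open>l1\<close> and \<open>l2\<close>
    are; the third one is obtained for the real sequence \<open>u\<close> itself.\<close>
  define v where "v k = complex_of_real (u k)" for k
  from 2 have "solves_ivp m a b f g x" "t \<in> tuples m" "\<beta> < m" and n: "t ! \<beta> = mu t"
    by simp_all
  note diag = solves_ivp_on_diagonal[OF this, folded u_def]
  have v: "v (Suc (Suc k)) + of_real a * v (Suc k) + of_real b * v k = 0" for k
  proof -
    have "v (Suc (Suc k)) + of_real a * v (Suc k) + of_real b * v k
          = of_real (u (Suc (Suc k)) + a * u (Suc k) + b * u k)"
      by (simp add: v_def)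
    thus ?thesis
      by (simp only: diag(1) of_real_0)
  qed
  have "proots [:complex_of_real b, complex_of_real a, 1:] = {#l1, l2#}"
    using assms(2) by (simp add: map_poly_pCons)
  note vieta = vieta_quadratic[OF this]
  have complex_case: "u (mu t) = r powi (int (mu t) - 1) * sin (real (mu t) * \<theta>) / sin \<theta> * u 1
               - r ^ mu t * sin ((real (mu t) - 1) * \<theta>) / sin \<theta> * u 0"
    if "r > 0" and \<theta>: "\<theta> \<in> {0<..<2 * pi} - {pi}"
      and l: "l1 = complex_of_real r * (complex_of_real (cos \<theta>) + \<i> * complex_of_real (sin \<theta>))"
             "l2 = complex_of_real r * (complex_of_real (cos \<theta>) - \<i> * complex_of_real (sin \<theta>))"
    for r \<theta>
  proof (rule linear_recurrence_complex_roots[where u = u and p = a and q = b, OF diag(1)])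
    show "a = - (2 * r * cos \<theta>)"
      using arg_cong[OF vieta(1), of Re] by (simp add: l)
    have "b = r * (r * (cos \<theta> * cos \<theta>)) + r * (r * (sin \<theta> * sin \<theta>))"
      using arg_cong[OF vieta(2), of Re] by (simp add: l algebra_simps)
    also have "\<dots> = r\<^sup>2 * ((sin \<theta>)\<^sup>2 + (cos \<theta>)\<^sup>2)"
      by (simp only: power2_eq_square ring_distribs ac_simps)
    finally show "b = r\<^sup>2"
      by simp
    show "sin \<theta> \<noteq> 0"
    proof (cases "\<theta> < pi")
      case True
      thus ?thesis
        using \<theta> sin_gt_zero[of \<theta>] by simp
    next
      case False
      thus ?thesis
        using \<theta> sin_lt_zero[of \<theta>] by simp
    qed
  qed (use \<open>r > 0\<close> in simp)
  have distinct_case: "complex_of_real (u (mu t)) =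
      (l1 ^ mu t - l2 ^ mu t) / (l1 - l2) * complex_of_real (u 1)
      - (l2 * l1 ^ mu t - l1 * l2 ^ mu t) / (l1 - l2) * complex_of_real (u 0)" if "l1 \<noteq> l2"
    using linear_recurrence_distinct_roots[where u = v and n = "mu t", OF v vieta that]
    by (simp only: v_def)
  have double_case: "complex_of_real (u (mu t)) =
      of_nat (mu t) * l1 ^ (mu t - 1) * complex_of_real (u 1)
      - (of_nat (mu t) - 1) * l1 ^ mu t * complex_of_real (u 0)" if "l1 = l2"
    using linear_recurrence_double_root[where u = v and l = l1 and n = "mu t",
        OF v vieta[folded that]]
    by (simp only: v_def)
  show ?case
    unfolding Let_def n diag(4)[symmetric] diag(2,3)[symmetric]
    by (intro conjI impI allI; (elim conjE)?)
      (rule distinct_case double_case complex_case; assumption)+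
qed

end
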